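(* Let $G=(U\sqcup W,E)$ be a bipartite directed graph with vertex classes $U$ and $W$. The following statements are equivalent: (1) $G$ is semi-balanced. (2) $G$ can be obtained from the standard orientation (of the underlying bipartite graph) by successively reversing directed cuts. (3) $G$ can be obtained from the standard orientation by reversing (at once) some disjoint directed cuts. (4) There is a function $l\colon U\sqcup W\to\mathbf{Z}$ such that $l(h)-l(t)=1$ for each edge $\overrightarrow{th}$ of $G$.
   Context: A directed graph is an orientation of a finite graph without loops and multiple edges; $\overrightarrow{th}$ denotes an edge with tail $t$ and head $h$. It is bipartite with classes $U$ and $W$ if each edge has one endpoint in $U$ and one in $W$. The standard orientation is the one in which each edge is oriented from $U$ to $W$. A cycle is a cycle of the underlying undirected graph; it is semi-balanced if it has the same number of edges going in the two directions around the cycle. A directed graph is semi-balanced if all of its cycles are semi-balanced. A cut is a set of edges obtained by partitioning the vertex set into two classes and taking all edges between the classes. A cut in a directed graph is directed if it arises from a partition such that each edge of the cut has its head in the same class. Reversing a directed cut means reversing the orientation of each of its edges. *)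

theory Defs
  imports "Graph_Theory.Graph_Theory"
begin

text \<open>
  An edge with tail \<open>t\<close> and head \<open>h\<close> is the pair \<open>(t, h)\<close>.  In \<open>pair_digraph\<close> opposite arcs
  \<open>(u, v)\<close>, \<open>(v, u)\<close> may coexist; an orientation of a graph without multiple edges excludes them.
\<close>

definition oriented_graph :: "'a pair_pre_digraph \<Rightarrow> bool" where
  "oriented_graph G \<longleftrightarrow>
     pair_digraph G \<and> (\<forall>u v. (u, v) \<in> parcs G \<longrightarrow> (v, u) \<notin> parcs G)"

definition bipartite_with :: "'a pair_pre_digraph \<Rightarrow> 'a set \<Rightarrow> 'a set \<Rightarrow> bool" where
  "bipartite_with G U W \<longleftrightarrow>
     pverts G = U \<union> W \<and> U \<inter> W = {} \<and>
     (\<forall>(t, h) \<in> parcs G. t \<in> U \<and> h \<in> W \<or> t \<in> W \<and> h \<in> U)"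

definition standard_orientation ::
    "'a pair_pre_digraph \<Rightarrow> 'a set \<Rightarrow> 'a set \<Rightarrow> 'a pair_pre_digraph" where
  "standard_orientation G U W =
     \<lparr> pverts = pverts G, parcs = {(u, w) \<in> parcs (mk_symmetric G). u \<in> U \<and> w \<in> W} \<rparr>"

text \<open>
  The underlying undirected graph is represented by \<open>mk_symmetric G\<close>, which contains both
  directions of every edge.  The length bound removes the closed walks \<open>[(u, v), (v, u)]\<close> that
  run back and forth along one edge, which the library also calls cycles.
\<close>

definition undirected_cycle :: "'a pair_pre_digraph \<Rightarrow> ('a \<times> 'a) awalk \<Rightarrow> bool" where
  "undirected_cycle G p \<longleftrightarrow> pre_digraph.cycle (with_proj (mk_symmetric G)) p \<and> 3 \<le> length p"

definition semi_balanced_cycle :: "'a pair_pre_digraph \<Rightarrow> ('a \<times> 'a) awalk \<Rightarrow> bool" where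
  "semi_balanced_cycle G p \<longleftrightarrow>
     card {(u, v) \<in> set p. (u, v) \<in> parcs G} = card {(u, v) \<in> set p. (v, u) \<in> parcs G}"

definition semi_balanced :: "'a pair_pre_digraph \<Rightarrow> bool" where
  "semi_balanced G \<longleftrightarrow> (\<forall>p. undirected_cycle G p \<longrightarrow> semi_balanced_cycle G p)"

definition vertex_bipartition :: "'a pair_pre_digraph \<Rightarrow> 'a set \<Rightarrow> 'a set \<Rightarrow> bool" where
  "vertex_bipartition G A B \<longleftrightarrow>
     A \<noteq> {} \<and> B \<noteq> {} \<and> A \<inter> B = {} \<and> A \<union> B = pverts G"

definition edge_cut :: "'a pair_pre_digraph \<Rightarrow> 'a set \<Rightarrow> 'a set \<Rightarrow> ('a \<times> 'a) set" where
  "edge_cut G A B = {(t, h) \<in> parcs G. t \<in> A \<and> h \<in> B \<or> t \<in> B \<and> h \<in> A}"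

text \<open>The two classes play symmetric roles, so the one containing the heads may be called \<open>B\<close>.\<close>

definition directed_cut :: "'a pair_pre_digraph \<Rightarrow> ('a \<times> 'a) set \<Rightarrow> bool" where
  "directed_cut G C \<longleftrightarrow>
     (\<exists>A B. vertex_bipartition G A B \<and> C = edge_cut G A B \<and> (\<forall>(t, h) \<in> C. h \<in> B))"

definition reverse_arcs :: "('a \<times> 'a) set \<Rightarrow> 'a pair_pre_digraph \<Rightarrow> 'a pair_pre_digraph" where
  "reverse_arcs C G = G\<lparr> parcs := (parcs G - C) \<union> C\<inverse> \<rparr>"

definition cut_reversal :: "'a pair_pre_digraph \<Rightarrow> 'a pair_pre_digraph \<Rightarrow> bool" where
  "cut_reversal G H \<longleftrightarrow> (\<exists>C. directed_cut G C \<and> H = reverse_arcs C G)"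

text \<open>In \<open>reachable_by_cut_reversals\<close> each cut is directed in the orientation current at that step.\<close>

definition reachable_by_cut_reversals ::
    "'a pair_pre_digraph \<Rightarrow> 'a pair_pre_digraph \<Rightarrow> bool" where
  "reachable_by_cut_reversals = cut_reversal\<^sup>*\<^sup>*"

definition reachable_by_disjoint_cut_reversal ::
    "'a pair_pre_digraph \<Rightarrow> 'a pair_pre_digraph \<Rightarrow> bool" where
  "reachable_by_disjoint_cut_reversal G H \<longleftrightarrow>
     (\<exists>\<C>. (\<forall>C \<in> \<C>. directed_cut G C) \<and> pairwise disjnt \<C> \<and> H = reverse_arcs (\<Union>\<C>) G)"

end

theory Submission
  imports Defs
begin

text \<open>
  Statement (4), the existence of a potential \<open>l\<close> that grows by one along every edge, is the hub.

  Give an edge weight \<open>1\<close> when it is traversed forwards and \<open>-1\<close> when it is traversed backwards.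
  A cycle is semi-balanced iff its total weight is \<open>0\<close>.  The increments of a potential telescope
  around a cycle, so (4) implies (1).  Conversely, if all cycles have weight \<open>0\<close>, then so do all
  closed walks, because a closed walk splits into cycles; hence the weight of a walk depends
  only on its ends, and the weight of a walk from a fixed root of each component is a potential
  (\<open>potential_if_cycles_zero\<close>).

  Subtracting \<open>2\<close> from a potential on the head side of a directed cut turns it into a potential
  for the graph with that cut reversed (\<open>potential_reverse_cut\<close>).  The standard orientation has
  the potential that is \<open>0\<close> on \<open>U\<close> and \<open>1\<close> on \<open>W\<close>, so (2) implies (4).

  For (4) implies (3), let \<open>g\<close> be half the difference, rounded down, between the standard potential
  and \<open>l\<close>.  Along an edge of the standard orientation \<open>g\<close> stays constant if the edge has the same
  direction in \<open>G\<close>, and grows by exactly one if it does not.  The edges on which \<open>g\<close> jumps from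
  \<open>k - 1\<close> to \<open>k\<close> form a directed cut, and these cuts are disjoint (\<open>reverse_steps_disjoint_cuts\<close>).

  Finally, (3) implies (2) since reversing one cut of a disjoint family leaves the others
  intact as directed cuts, so that they can be reversed one after another
  (\<open>disjoint_cuts_successively\<close>).
\<close>

section \<open>Potentials from vanishing cycle sums\<close>

text \<open>
  Induction on the length: a closed walk that is not a cycle revisits a vertex, and the part
  between the two visits and the remainder are both shorter closed walks.
\<close>

lemma (in wf_digraph) closed_walk_sum_zero:
  fixes c :: "'b \<Rightarrow> 'c :: ab_group_add"
  assumes cyc: "\<And>p. cycle p \<Longrightarrow> sum_list (map c p) = 0"
  assumes "awalk u p u"
  shows "sum_list (map c p) = 0"
  using assms(2)
proof (induction "length p" arbitrary: u p rule: less_induct)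
  case less
  show ?case
  proof (cases p)
    case (Cons e es)
    show ?thesis
    proof (cases "distinct (tl (awalk_verts u p))")
      case True
      then have "cycle p" using less.prems Cons by (auto simp: cycle_def)
      then show ?thesis by (rule cyc)
    next
      case False
      from less.prems Cons have e: "e \<in> arcs G" "tail G e = u" and es: "awalk (head G e) es u"
        by (auto simp: awalk_Cons_iff)
      from False Cons have "\<not> distinct (awalk_verts (head G e) es)" by simp
      from awalk_cyc_decompE'[OF es this] obtain q r s w where
        dec: "es = q @ r @ s" "closed_w r"
        and walks: "awalk (head G e) q w" "awalk w r w" "awalk w s u"
        by metis
      have "r \<noteq> []" using dec(2) by (auto simp: closed_w_def)
      have "awalk (head G e) (q @ s) u" using walks(1,3) by (rule awalk_appendI)
      then have "awalk u (e # q @ s) u" using e by (auto simp: awalk_Cons_iff)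
      then have "sum_list (map c (e # q @ s)) = 0"
        using \<open>r \<noteq> []\<close> Cons dec(1) by (intro less.hyps) auto
      moreover have "sum_list (map c r) = 0"
        using less.hyps[of r] walks(2) Cons dec(1) by simp
      ultimately show ?thesis using Cons dec(1) by (simp add: algebra_simps)
    qed
  qed simp
qed

text \<open>
  Walks to \<open>v\<close> from a root of the component of \<open>v\<close> all have the same sum, which serves as \<open>l v\<close>.
  Symmetry makes reachability an equivalence, so the ends of an arc can be reached from the same
  vertices, and the choice of the root, which depends only on this set, agrees for them.
\<close>

lemma (in sym_digraph) potential_if_cycles_zero:
  fixes c :: "'b \<Rightarrow> 'c :: ab_group_add"
  assumes cyc: "\<And>p. cycle p \<Longrightarrow> sum_list (map c p) = 0"
  obtains l where "\<And>e. e \<in> arcs G \<Longrightarrow> l (head G e) - l (tail G e) = c e"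
proof -
  define root where "root v = (SOME r. r \<rightarrow>\<^sup>* v)" for v
  define walk where "walk v = (SOME p. awalk (root v) p v)" for v
  have walk: "awalk (root v) (walk v) v" if "v \<in> verts G" for v
  proof -
    have "v \<rightarrow>\<^sup>* v" using that by simp
    then have "root v \<rightarrow>\<^sup>* v" unfolding root_def by (rule someI)
    then show ?thesis unfolding walk_def reachable_awalk by (rule someI_ex)
  qed
  show ?thesis
  proof
    fix e assume e: "e \<in> arcs G"
    let ?t = "tail G e" and ?h = "head G e"
    have "?t \<rightarrow>\<^sup>* ?h" using e by (intro reachable_adjI in_arcs_imp_in_arcs_ends)
    moreover from this have ht: "?h \<rightarrow>\<^sup>* ?t" by (rule symmetric_reachable')
    ultimately have "r \<rightarrow>\<^sup>* ?t \<longleftrightarrow> r \<rightarrow>\<^sup>* ?h" for r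
      using reachable_trans by blast
    then have root: "root ?t = root ?h" by (simp add: root_def)
    have wt: "awalk (root ?h) (walk ?t) ?t" and wh: "awalk (root ?h) (walk ?h) ?h"
      using walk[of ?t] walk[of ?h] e root by simp_all
    \<comment> \<open>Two walks from the root to the head are compared by closing both with the same walk back.\<close>
    have "root ?h \<rightarrow>\<^sup>* ?h" using wh by (rule reachable_awalkI)
    then have "?h \<rightarrow>\<^sup>* root ?h" by (rule symmetric_reachable')
    then obtain q where q: "awalk ?h q (root ?h)" by (auto simp: reachable_awalk)
    have "awalk ?t (e # q) (root ?h)" using q e by (auto simp: awalk_Cons_iff)
    then have "sum_list (map c (walk ?t @ e # q)) = 0"
      using closed_walk_sum_zero[OF cyc awalk_appendI[OF wt]] by blast
    moreover have "sum_list (map c (walk ?h @ q)) = 0"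
      using closed_walk_sum_zero[OF cyc awalk_appendI[OF wh q]] by blast
    ultimately have "sum_list (map c (walk ?h)) = sum_list (map c (walk ?t)) + c e"
      by (simp add: add.assoc[symmetric]) (metis add_right_cancel)
    then show "sum_list (map c (walk ?h)) - sum_list (map c (walk ?t)) = c e"
      by simp
  qed
qed

lemma (in pre_digraph) cas_sum_increments:
  fixes l :: "'a \<Rightarrow> 'c :: ab_group_add"
  assumes "cas u p v"
  shows "(\<Sum>e\<leftarrow>p. l (head G e) - l (tail G e)) = l v - l u"
  using assms by (induction p arbitrary: u) (auto simp: algebra_simps)


section \<open>Semi-balanced graphs and potentials\<close>

definition potential :: "'a pair_pre_digraph \<Rightarrow> ('a \<Rightarrow> int) \<Rightarrow> bool" where
  "potential G l \<longleftrightarrow> (\<forall>(t, h) \<in> parcs G. l h - l t = 1)"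

text \<open>The value outside \<open>parcs G\<close> is meant for arcs of \<open>G\<close> that are traversed backwards.\<close>

definition traversal_sign :: "'a pair_pre_digraph \<Rightarrow> 'a \<times> 'a \<Rightarrow> int" where
  "traversal_sign G e = (if e \<in> parcs G then 1 else - 1)"

lemma parcs_mk_symmetric_pair:
  "(u, v) \<in> parcs (mk_symmetric (with_proj G)) \<longleftrightarrow> (u, v) \<in> parcs G \<or> (v, u) \<in> parcs G"
  by (auto simp: parcs_mk_symmetric intro: bexI[of _ "(u, v)"] bexI[of _ "(v, u)"])

lemma semi_balanced_cycle_iff_sum_zero:
  assumes G: "oriented_graph G"
    and p: "set p \<subseteq> parcs (mk_symmetric (with_proj G))" "distinct p"
  shows "semi_balanced_cycle G p \<longleftrightarrow> sum_list (map (traversal_sign G) p) = 0"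
proof -
  let ?F = "{(u, v) \<in> set p. (u, v) \<in> parcs G}" and ?B = "{(u, v) \<in> set p. (v, u) \<in> parcs G}"
  have split: "set p = ?F \<union> ?B" using p(1) by (auto simp: parcs_mk_symmetric_pair)
  have disj: "?F \<inter> ?B = {}" using G by (auto simp: oriented_graph_def)
  have fin: "finite ?F" "finite ?B" by (auto intro: finite_subset[of _ "set p"])
  have "sum_list (map (traversal_sign G) p) = sum (traversal_sign G) (set p)"
    using p(2) by (simp add: sum_list_distinct_conv_sum_set)
  also have "\<dots> = sum (traversal_sign G) ?F + sum (traversal_sign G) ?B"
    by (subst split, rule sum.union_disjoint[OF fin disj])
  also have "sum (traversal_sign G) ?F = sum (\<lambda>_. 1) ?F"
    by (rule sum.cong) (auto simp: traversal_sign_def)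
  also have "sum (traversal_sign G) ?B = sum (\<lambda>_. - 1) ?B"
    using G by (intro sum.cong) (auto simp: traversal_sign_def oriented_graph_def)
  finally have "sum_list (map (traversal_sign G) p) = int (card ?F) - int (card ?B)"
    by (simp only: sum_negf sum_constant)
  then show ?thesis unfolding semi_balanced_cycle_def by linarith
qed

lemma semi_balanced_iff_potential:
  assumes G: "oriented_graph G"
  shows "semi_balanced G \<longleftrightarrow> (\<exists>l. potential G l)"
proof -
  from G interpret G: pair_digraph G by (simp add: oriented_graph_def)
  let ?S = "mk_symmetric (with_proj G)"
  have "pair_digraph ?S" by (rule G.digraph_mk_symmetric)
  then interpret S: pair_digraph ?S .
  interpret S: pair_sym_digraph ?S
    by unfold_locales (rule symmetric_mk_symmetric)
  have oriented: "(u, v) \<in> parcs G \<Longrightarrow> (v, u) \<notin> parcs G" for u v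
    using G by (simp add: oriented_graph_def)
  show ?thesis
  proof
    assume sb: "semi_balanced G"
    have "sum_list (map (traversal_sign G) p) = 0" if cyc: "S.cycle p" for p
    proof (cases "3 \<le> length p")
      case True
      then have "semi_balanced_cycle G p"
        using sb cyc by (simp add: semi_balanced_def undirected_cycle_def)
      moreover have "set p \<subseteq> parcs ?S" "distinct p"
        using cyc by (auto simp: S.cycle_conv S.awalk_def)
      ultimately show ?thesis using semi_balanced_cycle_iff_sum_zero[OF G] by simp
    next
      \<comment> \<open>Without loops, only the walks back and forth along one edge remain.\<close>
      case False
      obtain u where u: "S.awalk u p u" "2 \<le> length p"
        using cyc by (auto simp: S.cycle_digraph_conv)
      then have "length p = 2" using False by simp
      then obtain e f where "p = [e, f]"
        by (auto simp: numeral_2_eq_2 length_Suc_conv)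
      with u obtain v where "p = [(u, v), (v, u)]" and "(u, v) \<in> parcs ?S"
        by (cases e, cases f) (auto simp: S.awalk_Cons_iff S.awalk_Nil_iff)
      then show ?thesis
        using oriented by (auto simp: traversal_sign_def parcs_mk_symmetric_pair)
    qed
    from S.potential_if_cycles_zero[OF this] obtain l where
      l: "\<And>e. e \<in> parcs ?S \<Longrightarrow> l (snd e) - l (fst e) = traversal_sign G e"
      by blast
    have "potential G l"
      unfolding potential_def
    proof safe
      fix t h assume "(t, h) \<in> parcs G"
      then show "l h - l t = 1"
        using l[of "(t, h)"] by (simp add: parcs_mk_symmetric_pair traversal_sign_def)
    qed
    then show "\<exists>l. potential G l" by blast
  next
    assume "\<exists>l. potential G l"
    then obtain l where l: "potential G l" ..
    have sign: "traversal_sign G e = l (snd e) - l (fst e)" if "e \<in> parcs ?S" for e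
      using l that by (cases e) (auto simp: traversal_sign_def potential_def parcs_mk_symmetric_pair)
    show "semi_balanced G"
      unfolding semi_balanced_def
    proof (intro allI impI)
      fix p assume "undirected_cycle G p"
      then have "S.cycle p" by (simp add: undirected_cycle_def)
      then obtain u where p: "set p \<subseteq> parcs ?S" "distinct p" "pcas u p u"
        by (auto simp: S.cycle_conv S.awalk_def)
      have "map (traversal_sign G) p = map (\<lambda>e. l (snd e) - l (fst e)) p"
        using p(1) sign by (auto intro!: map_cong)
      then have "sum_list (map (traversal_sign G) p) = l u - l u"
        using S.cas_sum_increments[OF p(3), of l] by (simp only:)
      then show "semi_balanced_cycle G p"
        using semi_balanced_cycle_iff_sum_zero[OF G p(1,2)] by simp
    qed
  qed
qed


section \<open>Cut reversals and potentials\<close>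

lemma pair_wf_digraph_reverse_arcs:
  assumes "pair_wf_digraph G" "C \<subseteq> parcs G"
  shows "pair_wf_digraph (reverse_arcs C G)"
proof -
  from assms(1) interpret pair_wf_digraph G .
  show ?thesis
    using assms(2) wellformed' by unfold_locales (fastforce simp: reverse_arcs_def)+
qed

lemma directed_cut_subset_parcs: "directed_cut G C \<Longrightarrow> C \<subseteq> parcs G"
  by (auto simp: directed_cut_def edge_cut_def)

text \<open>
  Lowering the head side by \<open>2\<close> changes the increment along an edge of the cut from \<open>1\<close> to \<open>-1\<close>,
  as its reversal requires; any other edge has both ends on the same side.
\<close>

lemma potential_reverse_cut:
  assumes wf: "pair_wf_digraph G" and l: "potential G l"
    and AB: "vertex_bipartition G A B" and dir: "\<forall>(t, h) \<in> edge_cut G A B. h \<in> B"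
  shows "potential (reverse_arcs (edge_cut G A B) G) (\<lambda>v. l v - (if v \<in> B then 2 else 0))"
proof -
  from wf interpret pair_wf_digraph G .
  have sides: "A \<inter> B = {}" "A \<union> B = pverts G"
    using AB by (auto simp: vertex_bipartition_def)
  let ?C = "edge_cut G A B"
  have crossing: "l h = l t + 1 \<and> t \<notin> B \<and> h \<in> B" if "(t, h) \<in> ?C" for t h
    using that l dir sides(1) by (auto simp: edge_cut_def potential_def)
  have same_side: "l h = l t + 1 \<and> (t \<in> B \<longleftrightarrow> h \<in> B)" if "(t, h) \<in> parcs G - ?C" for t h
    using that l sides(2) in_arcsD1[of t h] in_arcsD2[of t h]
    by (auto simp: edge_cut_def potential_def)
  show ?thesis
    unfolding potential_def
  proof safe
    fix t h assume "(t, h) \<in> parcs (reverse_arcs ?C G)"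
    then consider "(t, h) \<in> parcs G - ?C" | "(h, t) \<in> ?C" by (auto simp: reverse_arcs_def)
    then show "l h - (if h \<in> B then 2 else 0) - (l t - (if t \<in> B then 2 else 0)) = 1"
      by cases (auto dest!: crossing same_side simp del: Diff_iff)
  qed
qed

lemma potential_if_reachable:
  assumes "reachable_by_cut_reversals S G" "pair_wf_digraph S" "\<exists>l. potential S l"
  shows "\<exists>l. potential G l"
proof -
  have "pair_wf_digraph G \<and> (\<exists>l. potential G l)"
    using assms(1) unfolding reachable_by_cut_reversals_def
  proof (induction rule: rtranclp_induct)
    case base
    show ?case using assms(2,3) by simp
  next
    case (step H H')
    then obtain A B where AB: "vertex_bipartition H A B" "\<forall>(t, h) \<in> edge_cut H A B. h \<in> B"
      and H': "H' = reverse_arcs (edge_cut H A B) H"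
      by (auto simp: cut_reversal_def directed_cut_def)
    have "edge_cut H A B \<subseteq> parcs H" by (auto simp: edge_cut_def)
    then show ?case
      using step.IH AB H' pair_wf_digraph_reverse_arcs potential_reverse_cut by blast
  qed
  then show ?thesis ..
qed


section \<open>Disjoint directed cuts\<close>

lemma directed_cut_after_disjoint_reversal:
  assumes "directed_cut G D" "C \<subseteq> parcs G" "C \<inter> D = {}"
  shows "directed_cut (reverse_arcs C G) D"
proof -
  obtain A B where AB: "vertex_bipartition G A B" and D: "D = edge_cut G A B"
    and dir: "\<forall>(t, h) \<in> D. h \<in> B"
    using assms(1) by (auto simp: directed_cut_def)
  have "edge_cut (reverse_arcs C G) A B = D"
    using assms(2,3) unfolding D edge_cut_def reverse_arcs_def by auto
  moreover have "vertex_bipartition (reverse_arcs C G) A B"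
    using AB by (simp add: vertex_bipartition_def reverse_arcs_def)
  ultimately show ?thesis using dir by (auto simp: directed_cut_def)
qed

text \<open>
  Without antisymmetry the second reversal could undo part of the first one, when \<open>C\<close> contains
  an arc whose opposite is in \<open>D\<close>.
\<close>

lemma reverse_arcs_Un:
  assumes "antisym (parcs G)" "irrefl (parcs G)" "C \<subseteq> parcs G" "D \<subseteq> parcs G"
  shows "reverse_arcs D (reverse_arcs C G) = reverse_arcs (C \<union> D) G"
proof -
  have "C\<inverse> \<inter> D = {}" using assms unfolding antisym_def irrefl_def by blast
  then have "parcs G - C \<union> C\<inverse> - D \<union> D\<inverse> = parcs G - (C \<union> D) \<union> (C \<union> D)\<inverse>"
    by blast
  then show ?thesis by (simp add: reverse_arcs_def)
qed

lemma disjoint_cuts_successively: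
  assumes "finite \<C>" "antisym (parcs G)" "irrefl (parcs G)"
    and "\<forall>C \<in> \<C>. directed_cut G C" "pairwise disjnt \<C>"
  shows "reachable_by_cut_reversals G (reverse_arcs (\<Union>\<C>) G)"
  using assms
proof (induction \<C> rule: finite_induct)
  case empty
  show ?case by (simp add: reachable_by_cut_reversals_def reverse_arcs_def)
next
  case (insert C \<C>)
  let ?H = "reverse_arcs (\<Union>\<C>) G"
  have sub: "\<Union>\<C> \<subseteq> parcs G" "C \<subseteq> parcs G"
    using insert.prems directed_cut_subset_parcs by blast+
  have "\<Union>\<C> \<inter> C = {}"
    using insert.prems(4) insert.hyps(2) unfolding pairwise_insert disjnt_def by blast
  then have "directed_cut ?H C"
    using insert.prems(3) sub directed_cut_after_disjoint_reversal by blast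
  moreover have "reverse_arcs C ?H = reverse_arcs (\<Union>(insert C \<C>)) G"
    using reverse_arcs_Un[OF insert.prems(1,2) sub] by (simp add: Un_commute)
  ultimately have "cut_reversal ?H (reverse_arcs (\<Union>(insert C \<C>)) G)"
    unfolding cut_reversal_def by metis
  moreover have "reachable_by_cut_reversals G ?H"
    using insert by (simp add: pairwise_insert)
  ultimately show ?case
    unfolding reachable_by_cut_reversals_def by (rule rtranclp.rtrancl_into_rtrancl[rotated])
qed

text \<open>
  The cut at threshold \<open>k\<close> separates the vertices below \<open>k\<close> from the others.  Since \<open>g\<close> never
  decreases, all its edges point upwards; since \<open>g\<close> never jumps by more than one, an edge lies in
  at most one of these cuts.
\<close>

lemma reverse_steps_disjoint_cuts:
  fixes g :: "'a \<Rightarrow> int"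
  assumes wf: "pair_wf_digraph G"
    and g: "\<And>t h. (t, h) \<in> parcs G \<Longrightarrow> g h = g t \<or> g h = g t + 1"
  shows "reachable_by_disjoint_cut_reversal G (reverse_arcs {(t, h) \<in> parcs G. g h \<noteq> g t} G)"
proof -
  from wf interpret pair_wf_digraph G .
  define low where "low k = {v \<in> pverts G. g v < k}" for k
  define high where "high k = {v \<in> pverts G. k \<le> g v}" for k
  define cut where "cut k = edge_cut G (low k) (high k)" for k
  define K where "K = {k. low k \<noteq> {} \<and> high k \<noteq> {}}"
  have cut: "cut k = {(t, h) \<in> parcs G. g t = k - 1 \<and> g h = k}" for k
  proof -
    have "(t, h) \<in> cut k \<longleftrightarrow> g t = k - 1 \<and> g h = k" if "(t, h) \<in> parcs G" for t h
      using g[OF that] in_arcsD1[OF that] in_arcsD2[OF that] that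
      by (auto simp: cut_def edge_cut_def low_def high_def)
    moreover have "cut k \<subseteq> parcs G" by (auto simp: cut_def edge_cut_def)
    ultimately show ?thesis by auto
  qed
  have "directed_cut G (cut k)" if "k \<in> K" for k
  proof -
    have "vertex_bipartition G (low k) (high k)"
      using that by (auto simp: vertex_bipartition_def K_def low_def high_def)
    moreover have "\<forall>(t, h) \<in> cut k. h \<in> high k"
      unfolding cut high_def by (auto dest: in_arcsD2)
    ultimately show ?thesis unfolding directed_cut_def cut_def by blast
  qed
  moreover have "pairwise disjnt (cut ` K)"
    unfolding pairwise_def disjnt_def cut by auto
  moreover have "\<Union>(cut ` K) = {(t, h) \<in> parcs G. g h \<noteq> g t}"
  proof (intro equalityI subsetI)
    fix e assume "e \<in> \<Union>(cut ` K)"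
    then obtain k t h where "e = (t, h)" "(t, h) \<in> parcs G" "g t = k - 1" "g h = k"
      unfolding cut by blast
    then show "e \<in> {(t, h) \<in> parcs G. g h \<noteq> g t}" by simp
  next
    fix e assume "e \<in> {(t, h) \<in> parcs G. g h \<noteq> g t}"
    then obtain t h where e: "e = (t, h)" "(t, h) \<in> parcs G" "g h = g t + 1"
      using g by blast
    then have "t \<in> low (g h)" "h \<in> high (g h)"
      by (auto simp: low_def high_def dest: in_arcsD1 in_arcsD2)
    then have "g h \<in> K" by (auto simp: K_def)
    moreover have "e \<in> cut (g h)" using e by (simp add: cut)
    ultimately show "e \<in> \<Union>(cut ` K)" by blast
  qed
  ultimately show ?thesis
    unfolding reachable_by_disjoint_cut_reversal_def
    by (metis (no_types, lifting) imageE)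
qed


section \<open>The standard orientation\<close>

lemma parcs_standard_orientation:
  "(u, w) \<in> parcs (standard_orientation G U W) \<longleftrightarrow>
     u \<in> U \<and> w \<in> W \<and> ((u, w) \<in> parcs G \<or> (w, u) \<in> parcs G)"
  by (auto simp: standard_orientation_def parcs_mk_symmetric_pair)

lemma pverts_standard_orientation [simp]: "pverts (standard_orientation G U W) = pverts G"
  by (simp add: standard_orientation_def)

lemma pair_wf_digraph_standard_orientation:
  assumes "pair_wf_digraph G"
  shows "pair_wf_digraph (standard_orientation G U W)"
proof -
  from assms interpret pair_wf_digraph G .
  show ?thesis
    by unfold_locales (auto simp: parcs_standard_orientation dest: wellformed')
qed

lemma finite_parcs_standard_orientation:
  assumes "finite (parcs G)"
  shows "finite (parcs (standard_orientation G U W))"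
proof (rule finite_subset)
  show "parcs (standard_orientation G U W) \<subseteq> parcs G \<union> (parcs G)\<inverse>"
    by (auto simp: parcs_standard_orientation)
qed (use assms in simp)

lemma potential_standard_orientation:
  assumes "U \<inter> W = {}"
  shows "potential (standard_orientation G U W) (\<lambda>v. if v \<in> W then 1 else 0)"
  using assms by (auto simp: potential_def parcs_standard_orientation)

lemma disjoint_cuts_if_potential:
  assumes G: "oriented_graph G" and bip: "bipartite_with G U W" and l: "potential G l"
  shows "reachable_by_disjoint_cut_reversal (standard_orientation G U W) G"
proof -
  let ?S = "standard_orientation G U W"
  from G interpret pair_digraph G by (simp add: oriented_graph_def)
  have disj: "U \<inter> W = {}" using bip by (simp add: bipartite_with_def)
  \<comment> \<open>Halving is exact up to a constant on each component, where the parity of the difference of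
    the two potentials does not change; rounding down makes it uniform over all components.\<close>
  define g where "g v = ((if v \<in> W then 1 else 0) - l v) div 2" for v
  have keep: "g w = g u" if "u \<in> U" "w \<in> W" "(u, w) \<in> parcs G" for u w
  proof -
    have "l w = l u + 1" using l that(3) by (auto simp: potential_def)
    then show ?thesis using that disj by (auto simp: g_def)
  qed
  have flip: "g w = g u + 1" if "u \<in> U" "w \<in> W" "(w, u) \<in> parcs G" for u w
  proof -
    have "l w = l u - 1" using l that(3) by (auto simp: potential_def)
    then have "g w = (- l u + 2) div 2" using that(2) by (simp add: g_def)
    also have "\<dots> = g u + 1" using that(1) disj by (auto simp: g_def)
    finally show ?thesis .
  qed
  have arcs: "(u, w) \<in> parcs ?S \<and> g w \<noteq> g u \<longleftrightarrow> u \<in> U \<and> w \<in> W \<and> (w, u) \<in> parcs G" for u w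
    using keep[of u w] flip[of u w] by (auto simp: parcs_standard_orientation)
  have "reverse_arcs {(u, w) \<in> parcs ?S. g w \<noteq> g u} ?S = G"
  proof -
    have "parcs ?S - {(u, w). u \<in> U \<and> w \<in> W \<and> (w, u) \<in> parcs G} \<union>
          {(u, w). u \<in> U \<and> w \<in> W \<and> (w, u) \<in> parcs G}\<inverse> = parcs G"
      using G bip
      by (auto simp: oriented_graph_def bipartite_with_def parcs_standard_orientation)
    then show ?thesis unfolding arcs by (simp add: reverse_arcs_def)
  qed
  moreover have "reachable_by_disjoint_cut_reversal ?S
      (reverse_arcs {(u, w) \<in> parcs ?S. g w \<noteq> g u} ?S)"
    using keep flip
    by (intro reverse_steps_disjoint_cuts pair_wf_digraph_standard_orientation pair_wf_digraph)
       (auto simp: parcs_standard_orientation)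
  ultimately show ?thesis by simp
qed

lemma cut_reversals_if_disjoint_cuts:
  assumes fin: "finite (parcs G)" and disj: "U \<inter> W = {}"
    and reach: "reachable_by_disjoint_cut_reversal (standard_orientation G U W) H"
  shows "reachable_by_cut_reversals (standard_orientation G U W) H"
proof -
  let ?S = "standard_orientation G U W"
  obtain \<C> where \<C>: "\<forall>C \<in> \<C>. directed_cut ?S C" "pairwise disjnt \<C>"
    and H: "H = reverse_arcs (\<Union>\<C>) ?S"
    using reach by (auto simp: reachable_by_disjoint_cut_reversal_def)
  have "\<C> \<subseteq> Pow (parcs ?S)" using \<C>(1) directed_cut_subset_parcs by blast
  then have "finite \<C>"
    using finite_parcs_standard_orientation[OF fin] by (meson finite_Pow_iff finite_subset)
  moreover have "antisym (parcs ?S)" "irrefl (parcs ?S)"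
    using disj by (auto simp: antisym_def irrefl_def parcs_standard_orientation)
  ultimately show ?thesis
    unfolding H using \<C> by (intro disjoint_cuts_successively)
qed


section \<open>The equivalence\<close>

theorem theorem2p6:
  fixes G :: "'a pair_pre_digraph" and U W :: "'a set"
  assumes "oriented_graph G" and "bipartite_with G U W"
  shows "(semi_balanced G
            \<longleftrightarrow> reachable_by_cut_reversals (standard_orientation G U W) G)
       \<and> (reachable_by_cut_reversals (standard_orientation G U W) G
            \<longleftrightarrow> reachable_by_disjoint_cut_reversal (standard_orientation G U W) G)
       \<and> (reachable_by_disjoint_cut_reversal (standard_orientation G U W) G
            \<longleftrightarrow> (\<exists>l :: 'a \<Rightarrow> int. \<forall>(t, h) \<in> parcs G. l h - l t = 1))"
proof -
  let ?S = "standard_orientation G U W"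
  from assms(1) interpret pair_digraph G by (simp add: oriented_graph_def)
  have disj: "U \<inter> W = {}" using assms(2) by (simp add: bipartite_with_def)
  have pot_imp_disjoint: "reachable_by_disjoint_cut_reversal ?S G" if "\<exists>l. potential G l"
    using disjoint_cuts_if_potential[OF assms] that by blast
  have disjoint_imp_succ: "reachable_by_cut_reversals ?S G"
    if "reachable_by_disjoint_cut_reversal ?S G"
    using cut_reversals_if_disjoint_cuts[OF pair_finite_arcs disj that] .
  have succ_imp_pot: "\<exists>l. potential G l" if "reachable_by_cut_reversals ?S G"
    using potential_if_reachable[OF that]
      pair_wf_digraph_standard_orientation[OF pair_wf_digraph]
      potential_standard_orientation[OF disj] by blast
  show ?thesis
    using semi_balanced_iff_potential[OF assms(1)] pot_imp_disjoint disjoint_imp_succ succ_imp_pot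
    unfolding potential_def by blast
qed

end
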